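(* Let $\Theta=\{\langle \mu,\nu\rangle\in[0,1]^2 \mid \mu+\nu\le 1\}$. The mapping $E:\Theta\to[0,1]$, $E(\alpha)=1-\overline{JS}_{\mathrm{IF}}(\alpha,\alpha^{\complement})$, where $\alpha^{\complement}=\langle\nu_\alpha,\mu_\alpha\rangle$ for $\alpha=\langle\mu_\alpha,\nu_\alpha\rangle$, is an intuitionistic fuzzy entropy measure (IFEM) on $\Theta$.
   Context: For $\alpha=\langle\mu_\alpha,\nu_\alpha\rangle$, $\beta=\langle\mu_\beta,\nu_\beta\rangle\in\Theta$, $$\overline{JS}_{\mathrm{IF}}(\alpha,\beta)=\sqrt{\tfrac12\big(L(1-\mu_\alpha,1-\mu_\beta)+L(\nu_\alpha,\nu_\beta)\big)},\qquad L(p,q)=p\log_2\frac{2p}{p+q}+q\log_2\frac{2q}{p+q}\quad(p,q\ge0),$$ where any term whose leading factor is $0$ equals $0$ (including $0\cdot\log_2 0=0\cdot\log_2\frac{0}{0+0}=0$). A map $E:\Theta\to[0,1]$ is an IFEM on $\Theta$ if for all $\alpha,\beta\in\Theta$: (E1) $E(\alpha)=0$ iff $\alpha=\langle1,0\rangle$ or $\alpha=\langle0,1\rangle$; (E2) $E(\alpha)=1$ iff $\mu_\alpha=\nu_\alpha$; (E3) $E(\alpha)=E(\alpha^{\complement})$; (E4) $E(\alpha)\le E(\beta)$ whenever either $\mu_\alpha\le\mu_\beta\le\nu_\beta\le\nu_\alpha$ or $\mu_\alpha\ge\mu_\beta\ge\nu_\beta\ge\nu_\alpha$. *)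

theory Defs
  imports Complex_Main "HOL-Library.FuncSet"
begin

text \<open>An intuitionistic fuzzy value \<open>\<langle>\<mu>, \<nu>\<rangle>\<close> is the pair \<open>(\<mu>, \<nu>)\<close>, with projections \<open>fst\<close> and \<open>snd\<close>.\<close>

definition Theta :: "(real \<times> real) set" where
  "Theta = {(\<mu>, \<nu>). 0 \<le> \<mu> \<and> \<mu> \<le> 1 \<and> 0 \<le> \<nu> \<and> \<nu> \<le> 1 \<and> \<mu> + \<nu> \<le> 1}"

definition ifv_compl :: "real \<times> real \<Rightarrow> real \<times> real" where
  "ifv_compl \<alpha> = (snd \<alpha>, fst \<alpha>)"

text \<open>Only used for \<open>p, q \<ge> 0\<close>. The convention that a term with leading factor \<open>0\<close> is \<open>0\<close> holds
  automatically, since \<open>log\<close> and division are total and \<open>0 * x = 0\<close>.\<close>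

definition L :: "real \<Rightarrow> real \<Rightarrow> real" where
  "L p q = p * log 2 (2 * p / (p + q)) + q * log 2 (2 * q / (p + q))"

definition JS_IF :: "real \<times> real \<Rightarrow> real \<times> real \<Rightarrow> real" where
  "JS_IF \<alpha> \<beta> = sqrt (1 / 2 * (L (1 - fst \<alpha>) (1 - fst \<beta>) + L (snd \<alpha>) (snd \<beta>)))"

text \<open>The map \<open>E\<close> is total on pairs, but only its values on \<open>Theta\<close> are constrained.\<close>

definition IFEM :: "(real \<times> real \<Rightarrow> real) \<Rightarrow> bool" where
  "IFEM E \<longleftrightarrow>
     E \<in> Theta \<rightarrow> {0..1} \<and>
     (\<forall>\<alpha>\<in>Theta. E \<alpha> = 0 \<longleftrightarrow> \<alpha> = (1, 0) \<or> \<alpha> = (0, 1)) \<and>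
     (\<forall>\<alpha>\<in>Theta. E \<alpha> = 1 \<longleftrightarrow> fst \<alpha> = snd \<alpha>) \<and>
     (\<forall>\<alpha>\<in>Theta. E \<alpha> = E (ifv_compl \<alpha>)) \<and>
     (\<forall>\<alpha>\<in>Theta. \<forall>\<beta>\<in>Theta.
        (fst \<alpha> \<le> fst \<beta> \<and> fst \<beta> \<le> snd \<beta> \<and> snd \<beta> \<le> snd \<alpha>) \<or>
        (fst \<alpha> \<ge> fst \<beta> \<and> fst \<beta> \<ge> snd \<beta> \<and> snd \<beta> \<ge> snd \<alpha>)
        \<longrightarrow> E \<alpha> \<le> E \<beta>)"

end

theory Submission
  imports Defs
begin

text \<open>With \<open>S = L (1 - \<mu>) (1 - \<nu>) + L \<nu> \<mu>\<close> one has \<open>E = 1 - sqrt (S / 2)\<close>. Gibbs' inequality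
  \<open>p log a + q log b \<le> L p q\<close> for \<open>a + b = 2\<close> yields \<open>L \<ge> 0\<close> (take \<open>a = b = 1\<close>), with equality only
  for \<open>p = q\<close>, and, choosing \<open>a\<close>, \<open>b\<close> optimal for an inner pair \<open>p', q'\<close>, also that \<open>L\<close> grows when
  its two arguments move apart. Each logarithm in \<open>L p q\<close> is at most \<open>1\<close>, so \<open>L p q \<le> p + q\<close>, with
  equality only if \<open>p\<close> or \<open>q\<close> vanishes; hence \<open>S \<le> 2\<close>, with equality only at the two crisp values.\<close>

text \<open>Strictness of \<open>ln t < t - 1\<close> for \<open>t \<noteq> 1\<close>, taken at
  \<open>t = y / x\<close> and scaled by \<open>x\<close>; for \<open>x = 0\<close> the right side
  is 0 and the left is \<open>- y\<close>.\<close>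

lemma diff_less_mult_ln:
  fixes x y :: real
  assumes "0 \<le> x" "0 < y" "x \<noteq> y"
  shows "x - y < x * ln (x / y)"
proof (cases "x = 0")
  case False
  then have x: "0 < x" using assms by simp
  have "ln (y / x) \<noteq> y / x - 1"
    using ln_eq_minus_one[of "y / x"] x assms by auto
  moreover have "ln (y / x) \<le> y / x - 1"
    using x assms by (intro ln_le_minus_one) simp
  ultimately have "x * ln (y / x) < x * (y / x - 1)"
    using x by simp
  moreover have "x * (y / x - 1) = y - x"
    using x by (simp add: field_simps)
  moreover have "ln (x / y) = - ln (y / x)"
    using x assms by (simp add: ln_div)
  ultimately show ?thesis by simp
qed (use assms in simp)

lemma diff_le_mult_ln:
  fixes x y :: real
  assumes "0 \<le> x" "0 < y"
  shows "x - y \<le> x * ln (x / y)"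
  using diff_less_mult_ln[OF assms] by (cases "x = y") auto

text \<open>Exhibits \<open>L\<close> as a divergence from the mean of \<open>p\<close> and
  \<open>q\<close>, in natural logarithms, so that the bounds on \<open>x * ln (x / y)\<close>
  apply.\<close>

lemma L_ln: "L p q = (p * ln (p / ((p + q) / 2)) + q * ln (q / ((p + q) / 2))) / ln 2"
proof -
  have "x / ((p + q) / 2) = 2 * x / (p + q)" for x by simp
  then show ?thesis by (simp only: L_def log_def add_divide_distrib times_divide_eq_right)
qed

lemma L_commute: "L p q = L q p"
  by (simp add: L_def add.commute)

lemma L_same [simp]: "L p p = 0"
  by (simp add: L_def flip: mult_2)

lemma L_pos:
  assumes "0 \<le> p" "0 \<le> q" "p \<noteq> q"
  shows "0 < L p q"
proof -
  let ?m = "(p + q) / 2"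
  have m: "0 < ?m" "p \<noteq> ?m" "q \<noteq> ?m" using assms by auto
  have "p - ?m < p * ln (p / ?m)" "q - ?m < q * ln (q / ?m)"
    using diff_less_mult_ln assms m by blast+
  \<comment> \<open>The deviations from the mean cancel, leaving a strictly positive sum.\<close>
  moreover have "(p - ?m) + (q - ?m) = 0" by (simp add: field_simps)
  ultimately have "0 < p * ln (p / ?m) + q * ln (q / ?m)" by linarith
  then show ?thesis unfolding L_ln by simp
qed

lemma L_nonneg: "0 \<le> p \<Longrightarrow> 0 \<le> q \<Longrightarrow> 0 \<le> L p q"
  using L_pos[of p q] by (cases "p = q") auto

lemma L_eq_0_iff: "0 \<le> p \<Longrightarrow> 0 \<le> q \<Longrightarrow> L p q = 0 \<longleftrightarrow> p = q"
  using L_pos[of p q] by (cases "p = q") auto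

text \<open>Since \<open>ln 0 = 0\<close>, a vanishing weight \<open>a\<close> is only admissible if \<open>p\<close> vanishes too.\<close>

lemma mult_ln_gibbs:
  fixes p a m :: real
  assumes "0 \<le> p" "0 \<le> a" "a = 0 \<Longrightarrow> p = 0" "0 < m"
  shows "p - a * m \<le> p * ln (p / m) - p * ln a"
proof (cases "p = 0")
  case False
  then have pos: "0 < p" "0 < a" using assms by (auto simp: less_le)
  have "p - a * m \<le> p * ln (p / (a * m))"
    using pos assms by (intro diff_le_mult_ln) auto
  also have "ln (p / (a * m)) = ln (p / m) - ln a"
    using pos assms by (simp add: ln_div ln_mult)
  finally show ?thesis by (simp add: algebra_simps)
qed (use assms in simp)

lemma L_gibbs:
  assumes "0 \<le> p" "0 \<le> q" "0 \<le> a" "0 \<le> b" "a + b = 2"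
    and "a = 0 \<Longrightarrow> p = 0" "b = 0 \<Longrightarrow> q = 0"
  shows "p * log 2 a + q * log 2 b \<le> L p q"
proof (cases "p + q = 0")
  case True
  then have "p = 0" "q = 0" using assms by auto
  then show ?thesis by simp
next
  case False
  let ?m = "(p + q) / 2"
  have m: "0 < ?m" using False assms by simp
  have "p - a * ?m \<le> p * ln (p / ?m) - p * ln a" "q - b * ?m \<le> q * ln (q / ?m) - q * ln b"
    using mult_ln_gibbs assms m by blast+
  \<comment> \<open>The rescaled means keep the total \<open>p + q\<close>, so the linear terms
    cancel.\<close>
  moreover have "a * ?m + b * ?m = p + q"
    by (simp only: \<open>a + b = 2\<close> flip: distrib_right) simp
  ultimately have "p * ln a + q * ln b \<le> p * ln (p / ?m) + q * ln (q / ?m)"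
    by linarith
  then have "(p * ln a + q * ln b) / ln 2 \<le> L p q"
    unfolding L_ln by (intro divide_right_mono) auto
  then show ?thesis
    by (simp add: log_def add_divide_distrib)
qed

lemma L_mono_spread:
  assumes "0 \<le> p" "p \<le> p'" "p' \<le> q'" "q' \<le> q"
  shows "L p' q' \<le> L p q"
proof (cases "q' = 0")
  case True
  then have "p' = q'" using assms by simp
  then show ?thesis using assms L_nonneg[of p q] by simp
next
  case False
  then have q': "0 < q'" using assms by simp
  \<comment> \<open>These are the arguments of the logarithms in \<open>L p' q'\<close>, so the
    Gibbs bound is attained at the inner pair. Their sum is 2 only because
    \<open>q' > 0\<close>.\<close>
  define a b where "a = 2 * p' / (p' + q')" and "b = 2 * q' / (p' + q')"
  have ab: "0 \<le> a" "a \<le> 1" "1 \<le> b" "a = 0 \<Longrightarrow> p' = 0"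
    using assms q' by (auto simp: a_def b_def)
  have sum: "a + b = 2"
    using assms q' unfolding a_def b_def
    by (simp add: divide_eq_eq flip: add_divide_distrib)
  \<comment> \<open>As \<open>a \<le> 1 \<le> b\<close>, lowering \<open>p'\<close> to
    \<open>p\<close> and raising \<open>q'\<close> to \<open>q\<close> cannot decrease the linear
    form.\<close>
  have "(p' - p) * log 2 a \<le> 0"
  proof (cases "a = 0")
    case False
    then show ?thesis using ab assms by (intro mult_nonneg_nonpos) auto
  qed (use ab assms in auto)
  moreover have "0 \<le> (q - q') * log 2 b"
    using ab assms by (intro mult_nonneg_nonneg) auto
  ultimately have "p' * log 2 a + q' * log 2 b \<le> p * log 2 a + q * log 2 b"
    by (simp add: algebra_simps)
  also have "\<dots> \<le> L p q"
    using ab sum assms by (intro L_gibbs) auto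
  finally show ?thesis by (simp add: L_def a_def b_def)
qed

lemma mult_log_less:
  fixes p q :: real
  assumes "0 < p" "0 < q"
  shows "p * log 2 (2 * p / (p + q)) < p"
proof -
  have "log 2 (2 * p / (p + q)) < log 2 2"
    using assms by (subst log_less_cancel_iff) (auto simp: field_simps)
  then show ?thesis using assms by simp
qed

lemma L_0_left: "0 \<le> q \<Longrightarrow> L 0 q = q"
  by (cases "q = 0") (auto simp: L_def)

lemma L_less_add:
  assumes "0 < p" "0 < q"
  shows "L p q < p + q"
  unfolding L_def using mult_log_less[OF assms] mult_log_less[OF assms(2,1)]
  by (simp only: add.commute[of q p] add_strict_mono)

lemma L_eq_add_iff:
  assumes "0 \<le> p" "0 \<le> q"
  shows "L p q = p + q \<longleftrightarrow> p = 0 \<or> q = 0"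
  using L_less_add[of p q] L_0_left[of q] L_0_left[of p] L_commute[of p q] assms
  by fastforce

lemma L_le_add: "0 \<le> p \<Longrightarrow> 0 \<le> q \<Longrightarrow> L p q \<le> p + q"
  using L_less_add[of p q] L_eq_add_iff[of p q] by fastforce

theorem theorem2:
  shows "IFEM (\<lambda>\<alpha>. 1 - JS_IF \<alpha> (ifv_compl \<alpha>))"
proof -
  define S where "S \<mu> \<nu> = L (1 - \<mu>) (1 - \<nu>) + L \<nu> \<mu>" for \<mu> \<nu>
  have JS: "JS_IF (\<mu>, \<nu>) (ifv_compl (\<mu>, \<nu>)) = sqrt (S \<mu> \<nu> / 2)" for \<mu> \<nu>
    by (simp add: JS_IF_def ifv_compl_def S_def)
  have S_commute: "S \<mu> \<nu> = S \<nu> \<mu>" for \<mu> \<nu>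
    by (simp add: S_def L_commute)
  have S_bounds: "0 \<le> S \<mu> \<nu>" "S \<mu> \<nu> \<le> 2" if "(\<mu>, \<nu>) \<in> Theta" for \<mu> \<nu>
    using that L_nonneg[of "1 - \<mu>" "1 - \<nu>"] L_nonneg[of \<nu> \<mu>]
      L_le_add[of "1 - \<mu>" "1 - \<nu>"] L_le_add[of \<nu> \<mu>]
    by (auto simp: Theta_def S_def)
  have S_eq_0: "S \<mu> \<nu> = 0 \<longleftrightarrow> \<mu> = \<nu>" if "(\<mu>, \<nu>) \<in> Theta" for \<mu> \<nu>
    using that L_nonneg[of "1 - \<mu>" "1 - \<nu>"] L_nonneg[of \<nu> \<mu>] L_eq_0_iff[of \<nu> \<mu>]
    by (auto simp: Theta_def S_def)
  have S_eq_2: "S \<mu> \<nu> = 2 \<longleftrightarrow> (\<mu>, \<nu>) = (1, 0) \<or> (\<mu>, \<nu>) = (0, 1)"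
    if "(\<mu>, \<nu>) \<in> Theta" for \<mu> \<nu>
  proof -
    \<comment> \<open>The upper bounds for the two summands add up to exactly 2, so both must be
      attained.\<close>
    have "S \<mu> \<nu> = 2 \<longleftrightarrow> L (1 - \<mu>) (1 - \<nu>) = (1 - \<mu>) + (1 - \<nu>) \<and> L \<nu> \<mu> = \<nu> + \<mu>"
      using that L_le_add[of "1 - \<mu>" "1 - \<nu>"] L_le_add[of \<nu> \<mu>]
      by (auto simp: Theta_def S_def)
    also have "\<dots> \<longleftrightarrow> (\<mu> = 1 \<or> \<nu> = 1) \<and> (\<nu> = 0 \<or> \<mu> = 0)"
      using that L_eq_add_iff[of "1 - \<mu>" "1 - \<nu>"] L_eq_add_iff[of \<nu> \<mu>]
      by (auto simp: Theta_def)
    finally show ?thesis using that by (auto simp: Theta_def)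
  qed
  have S_antimono: "S \<mu>' \<nu>' \<le> S \<mu> \<nu>"
    if "(\<mu>, \<nu>) \<in> Theta" "\<mu> \<le> \<mu>'" "\<mu>' \<le> \<nu>'" "\<nu>' \<le> \<nu>" for \<mu> \<nu> \<mu>' \<nu>'
    \<comment> \<open>Complementing reverses the chain, so the pair of complements spreads as
      well.\<close>
    using that L_mono_spread[of "1 - \<nu>" "1 - \<nu>'" "1 - \<mu>'" "1 - \<mu>"] L_mono_spread[of \<mu> \<mu>' \<nu>' \<nu>]
    by (auto simp: Theta_def S_def L_commute)
  have Theta_commute: "(\<nu>, \<mu>) \<in> Theta" if "(\<mu>, \<nu>) \<in> Theta" for \<mu> \<nu>
    using that by (auto simp: Theta_def)
  show ?thesis
    unfolding IFEM_def
  proof (intro conjI ballI impI, goal_cases)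
    case 1
    show ?case using S_bounds by (auto simp: JS)
  next
    case (2 \<alpha>)
    then show ?case using S_eq_2 by (cases \<alpha>) (auto simp: JS)
  next
    case (3 \<alpha>)
    then show ?case using S_eq_0 by (cases \<alpha>) (auto simp: JS)
  next
    case (4 \<alpha>)
    show ?case
      using JS S_commute by (cases \<alpha>) (simp add: ifv_compl_def)
  next
    case (5 \<alpha> \<beta>)
    obtain \<mu> \<nu> \<mu>' \<nu>' where [simp]: "\<alpha> = (\<mu>, \<nu>)" "\<beta> = (\<mu>', \<nu>')"
      by (cases \<alpha>, cases \<beta>)
    have "S \<mu>' \<nu>' \<le> S \<mu> \<nu>"
      \<comment> \<open>Swapping components turns the second alternative of (E4) into the
        first.\<close>
      using 5 S_antimono[of \<mu> \<nu> \<mu>' \<nu>'] S_antimono[of \<nu> \<mu> \<nu>' \<mu>'] Theta_commute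
        S_commute[of \<mu> \<nu>] S_commute[of \<mu>' \<nu>'] by auto
    then show ?case by (simp add: JS)
  qed
qed

end
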